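(* Let $n \ge 2$ and $m \ge 1$ be integers, and let $\{x_0, x_1, \ldots, x_m\}$ be a set of $m+1$ distinct points of the Hamming cube $H_n$ with $x_0 = \mathbf{0}$. Then \[ \det(D) = (-1)^{m-1} 2^{m-1} \det \begin{pmatrix} 0 & u^T \\ u & G \end{pmatrix}. \]
   Context: $H_n$ is the set $\{0,1\}^n \subset \mathbb{R}^n$ with the metric $d(x,y) = \|x-y\|_1 = \sum_{k=1}^n |x_k - y_k|$. $\mathbf{0}$ is the zero vector of $\mathbb{R}^n$. $D = (d(x_i,x_j))_{i,j=0}^m$ is the $(m+1)\times(m+1)$ distance matrix. $G = (x_i \cdot x_j)_{i,j=1}^m$ is the $m \times m$ Gram matrix of $x_1,\ldots,x_m$. $u = (x_1\cdot x_1, \ldots, x_m \cdot x_m)^T \in \mathbb{R}^m$ is a column vector. The displayed block matrix is $(m+1)\times(m+1)$. *)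

theory Defs
  imports "Jordan_Normal_Form.Determinant"
begin

definition hamming_cube :: "nat \<Rightarrow> real vec set" where
  "hamming_cube n = {x \<in> carrier_vec n. \<forall>k<n. x $ k \<in> {0, 1}}"

definition l1_norm :: "real vec \<Rightarrow> real" where
  "l1_norm v = (\<Sum>k<dim_vec v. \<bar>v $ k\<bar>)"

definition l1_dist :: "real vec \<Rightarrow> real vec \<Rightarrow> real" where
  "l1_dist x y = l1_norm (x - y)"

definition distance_mat :: "nat \<Rightarrow> (nat \<Rightarrow> real vec) \<Rightarrow> real mat" where
  "distance_mat m x = mat (m + 1) (m + 1) (\<lambda>(i, j). l1_dist (x i) (x j))"

(* Matrix and vector indices start at 0, so index i below stands for the point x (i + 1);
   the point x 0 does not enter. *)

definition gram_mat :: "nat \<Rightarrow> (nat \<Rightarrow> real vec) \<Rightarrow> real mat" where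
  "gram_mat m x = mat m m (\<lambda>(i, j). x (i + 1) \<bullet> x (j + 1))"

definition gram_diag :: "nat \<Rightarrow> (nat \<Rightarrow> real vec) \<Rightarrow> real vec" where
  "gram_diag m x = vec m (\<lambda>i. x (i + 1) \<bullet> x (i + 1))"

definition bordered_mat :: "real vec \<Rightarrow> real mat \<Rightarrow> real mat" where
  "bordered_mat u G =
     four_block_mat (0\<^sub>m 1 1) (mat_of_rows (dim_vec u) [u]) (mat_of_cols (dim_vec u) [u]) G"

end

theory Submission
  imports Defs
begin

text \<open>On the cube, \<open>d(x, y) = x \<bullet> x + y \<bullet> y - 2 x \<bullet> y\<close>. Hence \<open>D\<close> arises from the bordered Gram matrix
  by scaling rows and columns and then adding the border row and column to all the others.\<close>

text \<open>Coordinates differ by -1, 0 or 1, so each absolute difference equals its own square; the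
  l1 distance is thus the squared Euclidean distance, which expands bilinearly.\<close>

lemma l1_dist_hamming_cube:
  assumes "x \<in> hamming_cube n" and "y \<in> hamming_cube n"
  shows "l1_dist x y = x \<bullet> x + y \<bullet> y - 2 * (x \<bullet> y)"
proof -
  have dim: "dim_vec x = n" "dim_vec y = n"
    using assms by (auto simp: hamming_cube_def)
  have "\<bar>x $ k - y $ k\<bar> = x $ k * x $ k + y $ k * y $ k - 2 * (x $ k * y $ k)" if "k < n" for k
  proof -
    have "x $ k \<in> {0, 1}" "y $ k \<in> {0, 1}"
      using assms that by (auto simp: hamming_cube_def)
    then show ?thesis by auto
  qed
  then have "l1_dist x y = (\<Sum>k<n. x $ k * x $ k + y $ k * y $ k - 2 * (x $ k * y $ k))"
    by (simp add: l1_dist_def l1_norm_def dim)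
  also have "\<dots> = x \<bullet> x + y \<bullet> y - 2 * (x \<bullet> y)"
    by (simp add: scalar_prod_def dim sum.distrib sum_subtractf sum_distrib_left
        atLeast0LessThan)
  finally show ?thesis .
qed

lemma bordered_mat_index:
  assumes "dim_vec u = m" and "G \<in> carrier_mat m m" and "i < Suc m" and "j < Suc m"
  shows "bordered_mat u G $$ (i, j) =
    (if i = 0 then if j = 0 then 0 else u $ (j - 1)
     else if j = 0 then u $ (i - 1) else G $$ (i - 1, j - 1))"
  using assms by (auto simp: bordered_mat_def mat_of_rows_index mat_of_cols_index)

lemma bordered_mat_carrier:
  assumes "dim_vec u = m" and "G \<in> carrier_mat m m"
  shows "bordered_mat u G \<in> carrier_mat (Suc m) (Suc m)"
  using assms by (auto simp: bordered_mat_def)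

text \<open>The new matrix is \<open>L * A\<close> with \<open>L\<close> lower triangular: its first
  column is constantly \<open>a\<close>, and its diagonal is \<open>a, b, ..., b\<close>.\<close>

lemma det_row_scale_add_first:
  fixes A :: "'a :: comm_ring_1 mat"
  assumes A: "A \<in> carrier_mat (Suc m) (Suc m)"
  shows "det (mat (Suc m) (Suc m) (\<lambda>(i, j). if i = 0 then a * A $$ (0, j)
      else a * A $$ (0, j) + b * A $$ (i, j))) = a * b ^ m * det A" (is "det ?M = _")
proof -
  \<comment> \<open>Each entry is a sum of two indicator terms, so that the product with
    \<open>A\<close> splits into two one-point sums. The inner test \<open>i = 0\<close> keeps the
    corner at \<open>a\<close> instead of \<open>a + b\<close>.\<close>
  define L where "L = mat (Suc m) (Suc m)
    (\<lambda>(i, k). (if k = 0 then a else 0) + (if k = i then if i = 0 then 0 else b else 0))"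
  have L: "L \<in> carrier_mat (Suc m) (Suc m)"
    by (simp add: L_def)
  have "?M = L * A"
  proof (rule eq_matI)
    fix i j assume "i < dim_row (L * A)" "j < dim_col (L * A)"
    then have ij: "i < Suc m" "j < Suc m"
      using A by (auto simp: L_def)
    then have "(L * A) $$ (i, j) = (\<Sum>k = 0..<Suc m.
        ((if k = 0 then a else 0) + (if k = i then if i = 0 then 0 else b else 0)) * A $$ (k, j))"
      using A by (simp add: L_def scalar_prod_def del: sum.op_ivl_Suc)
    also have "\<dots> = (\<Sum>k = 0..<Suc m. (if k = 0 then a * A $$ (k, j) else 0) +
        (if k = i then (if i = 0 then 0 else b) * A $$ (k, j) else 0))"
      by (rule sum.cong) (auto simp: algebra_simps)
    also have "\<dots> = a * A $$ (0, j) + (if i = 0 then 0 else b) * A $$ (i, j)"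
      using ij by (simp add: sum.distrib del: sum.op_ivl_Suc)
    finally show "?M $$ (i, j) = (L * A) $$ (i, j)"
      using ij by simp
  qed (use A in \<open>auto simp: L_def\<close>)
  moreover have "det L = a * b ^ m"
  proof -
    have "det L = prod_list (diag_mat L)"
      by (rule det_lower_triangular[OF _ L]) (auto simp: L_def)
    also have "\<dots> = (\<Prod>i = 0..<Suc m. L $$ (i, i))"
      using L by (simp add: prod_list_diag_prod)
    also have "\<dots> = L $$ (0, 0) * (\<Prod>i = 0..<m. L $$ (Suc i, Suc i))"
      by (rule prod.atLeast0_lessThan_Suc_shift[unfolded comp_def])
    also have "\<dots> = a * b ^ m"
      by (simp add: L_def)
    finally show ?thesis .
  qed
  ultimately show ?thesis
    using det_mult[OF L A] by simp
qed

text \<open>Transposition turns the column operation into the row operation and preserves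
  determinants.\<close>

lemma det_col_scale_add_first:
  fixes A :: "'a :: comm_ring_1 mat"
  assumes A: "A \<in> carrier_mat (Suc m) (Suc m)"
  shows "det (mat (Suc m) (Suc m) (\<lambda>(i, j). if j = 0 then a * A $$ (i, 0)
      else a * A $$ (i, 0) + b * A $$ (i, j))) = a * b ^ m * det A" (is "det ?M = _")
proof -
  let ?N = "mat (Suc m) (Suc m) (\<lambda>(i, j). if i = 0 then a * A\<^sup>T $$ (0, j)
      else a * A\<^sup>T $$ (0, j) + b * A\<^sup>T $$ (i, j))"
  have "?M\<^sup>T = ?N"
    using A by (intro eq_matI) auto
  moreover have "det ?M\<^sup>T = det ?M"
    by (rule det_transpose[of _ "Suc m"]) simp
  moreover have "det ?N = a * b ^ m * det A\<^sup>T"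
    using A by (intro det_row_scale_add_first) simp
  ultimately show ?thesis
    using det_transpose[OF A] by simp
qed

theorem lemma2p1:
  fixes n m :: nat and x :: "nat \<Rightarrow> real vec"
  assumes "n \<ge> 2" and "m \<ge> 1"
    and "\<forall>i\<le>m. x i \<in> hamming_cube n"
    and "inj_on x {0..m}"
    and "x 0 = 0\<^sub>v n"
  shows "det (distance_mat m x) =
    (-1) ^ (m - 1) * 2 ^ (m - 1) * det (bordered_mat (gram_diag m x) (gram_mat m x))"
proof -
  define B where "B = bordered_mat (gram_diag m x) (gram_mat m x)"
  have u: "dim_vec (gram_diag m x) = m" and G: "gram_mat m x \<in> carrier_mat m m"
    by (simp_all add: gram_diag_def gram_mat_def)
  have B: "B \<in> carrier_mat (Suc m) (Suc m)"
    unfolding B_def by (rule bordered_mat_carrier[OF u G])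
  \<comment> \<open>The border takes up index 0, so position \<open>i > 0\<close> belongs to the
    point \<open>x i\<close> without a shift. The zero corner fits the first case because
    \<open>x 0\<close> is the origin.\<close>
  have B_index: "B $$ (i, j) = (if i = 0 then x j \<bullet> x j else if j = 0 then x i \<bullet> x i else x i \<bullet> x j)"
    if "i < Suc m" "j < Suc m" for i j
    unfolding B_def bordered_mat_index[OF u G that]
    using that assms(5) by (auto simp: gram_diag_def gram_mat_def)
  \<comment> \<open>For \<open>i, j > 0\<close> this produces
    \<open>x j \<bullet> x j - 2 * (x i \<bullet> x j)\<close>, the distance short of the term
    \<open>x i \<bullet> x i\<close>.\<close>
  define C where "C = mat (Suc m) (Suc m) (\<lambda>(i, j). if i = 0 then 1 * B $$ (0, j)
      else 1 * B $$ (0, j) + (- 2) * B $$ (i, j))"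
  have C: "C \<in> carrier_mat (Suc m) (Suc m)"
    by (simp add: C_def)
  \<comment> \<open>Below its zero corner, column 0 of \<open>C\<close> holds
    \<open>- 2 * (x i \<bullet> x i)\<close>. The factor \<open>- 1 / 2\<close> turns this into the
    distance to the origin, which is also the term still missing in the other columns.\<close>
  have "distance_mat m x = mat (Suc m) (Suc m) (\<lambda>(i, j). if j = 0 then (- 1 / 2) * C $$ (i, 0)
      else (- 1 / 2) * C $$ (i, 0) + 1 * C $$ (i, j))" (is "_ = ?R")
  proof (rule eq_matI)
    fix i j assume "i < dim_row ?R" "j < dim_col ?R"
    then have ij: "i < Suc m" "j < Suc m"
      by auto
    have mem: "x i \<in> hamming_cube n" "x j \<in> hamming_cube n"
      using ij assms(3) by auto
    \<comment> \<open>Knowing the dimension makes inner products with the origin vanish, as row 0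
      and column 0 require.\<close>
    then have "x i \<in> carrier_vec n" "x j \<in> carrier_vec n"
      by (auto simp: hamming_cube_def)
    then show "distance_mat m x $$ (i, j) = ?R $$ (i, j)"
      using ij assms(5)
      by (auto simp: distance_mat_def C_def B_index l1_dist_hamming_cube[OF mem])
  qed (auto simp: distance_mat_def)
  then have "det (distance_mat m x) = (- 1 / 2) * det C"
    using det_col_scale_add_first[OF C, of "- 1 / 2" 1] by simp
  also have "det C = (- 2) ^ m * det B"
    unfolding C_def using det_row_scale_add_first[OF B, of 1 "- 2"] by simp
  \<comment> \<open>Since \<open>m \<ge> 1\<close>, one factor \<open>- 2\<close> is available to
    cancel \<open>- 1 / 2\<close>.\<close>
  also have "(- 1 / 2) * ((- 2) ^ m * det B) = (- 2) ^ (m - 1) * det B"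
    using assms(2) by (cases m) auto
  also have "(- 2 :: real) ^ (m - 1) = (- 1) ^ (m - 1) * 2 ^ (m - 1)"
    by (simp flip: power_mult_distrib)
  finally show ?thesis
    unfolding B_def .
qed

end
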